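(* The ternary $q$-Virasoro-Witt algebra is a one-parameter formal ternary hom-Nambu-Lie deformation of the ternary Virasoro-Witt algebra.
   Context: $\mathbb{N}$ denotes the natural numbers including zero, $K$ a field of characteristic zero, and $S_3$ the symmetric group on three letters. A ternary hom-Nambu-Lie algebra $(V,[\cdot,\cdot,\cdot],(\alpha,\beta))$ over $K$ consists of a $K$-vector space $V$, two $K$-linear maps $\alpha,\beta\colon V\to V$ (the twisting maps), and a $K$-trilinear map $[\cdot,\cdot,\cdot]\colon V\times V\times V\to V$ that is skew-symmetric, i.e. $[x_{\sigma(1)},x_{\sigma(2)},x_{\sigma(3)}]=\operatorname{sgn}(\sigma)[x_1,x_2,x_3]$ for all $x_1,x_2,x_3\in V$ and $\sigma\in S_3$, and satisfies, for all $x_1,\dots,x_5\in V$, the ternary hom-Nambu identity \begin{align*} [\alpha(x_1),\beta(x_2),[x_3,x_4,x_5]]={}&[[x_1,x_2,x_3],\alpha(x_4),\beta(x_5)]+[\alpha(x_3),[x_1,x_2,x_4],\beta(x_5)]\\ &+[\alpha(x_3),\beta(x_4),[x_1,x_2,x_5]]. \end{align*} A ternary Nambu-Lie algebra $(V,[\cdot,\cdot,\cdot])$ is the case $\alpha=\beta=\mathrm{id}_V$, i.e. it stands for $(V,[\cdot,\cdot,\cdot],(\mathrm{id}_V,\mathrm{id}_V))$. The ternary Virasoro-Witt algebra: let $W$ be a vector space over $\mathbb{C}$ with generating set $\{Q_n,R_n\}_{n\in\mathbb{Z}}$, and $[\cdot,\cdot,\cdot]\colon W\times W\times W\to W$ the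 $\mathbb{C}$-trilinear, skew-symmetric bracket defined on the generators by \begin{align*} [Q_k,Q_m,Q_n]&=(k-m)(m-n)(k-n)R_{k+m+n},\\ [Q_k,Q_m,R_n]&=(k-m)(Q_{k+m+n}+znR_{k+m+n}),\\ [Q_k,R_m,R_n]&=(n-m)R_{k+m+n},\\ [R_k,R_m,R_n]&=0. \end{align*} Whenever $z=\pm 2i$, this defines a ternary Nambu-Lie algebra $(W,[\cdot,\cdot,\cdot])$ over $\mathbb{C}$, called the ternary Virasoro-Witt algebra. The ternary $q$-Virasoro-Witt algebra: for $q\in\mathbb{C}$, let $\rho_q\colon W\to W$ be the $\mathbb{C}$-linear map defined on the generators by $\rho_q(Q_n):=q^nQ_n$ and $\rho_q(R_n):=q^nR_n$. With $[\cdot,\cdot,\cdot]_q:=\rho_q\circ[\cdot,\cdot,\cdot]$ and $z=\pm 2i$, the ternary hom-Nambu-Lie algebra $(W,[\cdot,\cdot,\cdot]_q,(\rho_q,\rho_q))$ is called the ternary $q$-Virasoro-Witt algebra; the case $q=1$ is the ternary Virasoro-Witt algebra. Formal deformations: for $n\in\mathbb{N}_{>0}$, an $n$-parameter formal ternary hom-Nambu-Lie deformation of a ternary hom-Nambu-Lie algebra $(V,[\cdot,\cdot,\cdot]_0,(\alpha_0,\beta_0))$ over $K$ is a ternary hom-Nambu-Lie algebra $(V[[t_1,\dots,t_n]],[\cdot,\cdot,\cdot]_t,(\alpha_t,\beta_t))$ over $K[[t_1,\dots,t_n]]$ (same notion, with scalars $K[[t_1,\dots,t_n]]$), where $t:=(t_1,\dots,t_n)$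 and $$[\cdot,\cdot,\cdot]_t=\sum_{i\in\mathbb{N}^n}[\cdot,\cdot,\cdot]_i\,t^i,\quad \alpha_t=\sum_{i\in\mathbb{N}^n}\alpha_i t^i,\quad \beta_t=\sum_{i\in\mathbb{N}^n}\beta_i t^i.$$ Here $i:=(i_1,\dots,i_n)\in\mathbb{N}^n$, $t^i:=t_1^{i_1}\cdots t_n^{i_n}$, each $[\cdot,\cdot,\cdot]_i\colon V\times V\times V\to V$ is a $K$-trilinear operation and $\alpha_i,\beta_i\colon V\to V$ are $K$-linear maps, extended homogeneously to a $K[[t_1,\dots,t_n]]$-trilinear operation and $K[[t_1,\dots,t_n]]$-linear maps, respectively, on $V[[t_1,\dots,t_n]]$. A map $f\colon V\to V$ is extended homogeneously when $f(at^i):=f(a)t^i$ for all $a\in V$ and $i\in\mathbb{N}^n$; the case of ternary maps is analogous. The maps $[\cdot,\cdot,\cdot]_0,\alpha_0,\beta_0$ are those with index $i=(0,\dots,0)$. *)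

theory Defs
  imports
    Complex_Main
    "HOL-Combinatorics.Permutations"
    "HOL-Computational_Algebra.Formal_Power_Series"
begin

section \<open>Ternary hom-Nambu-Lie algebras\<close>

definition trilinear_on ::
    "('k::comm_ring_1 \<Rightarrow> 'v::ab_group_add \<Rightarrow> 'v) \<Rightarrow> ('v \<Rightarrow> 'v \<Rightarrow> 'v \<Rightarrow> 'v) \<Rightarrow> bool" where
  "trilinear_on scale f \<longleftrightarrow>
     (\<forall>y w. module_hom scale scale (\<lambda>x. f x y w)) \<and>
     (\<forall>x w. module_hom scale scale (\<lambda>y. f x y w)) \<and>
     (\<forall>x y. module_hom scale scale (\<lambda>w. f x y w))"

definition skew_symmetric_on ::
    "('k::comm_ring_1 \<Rightarrow> 'v::ab_group_add \<Rightarrow> 'v) \<Rightarrow> ('v \<Rightarrow> 'v \<Rightarrow> 'v \<Rightarrow> 'v) \<Rightarrow> bool" where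
  "skew_symmetric_on scale f \<longleftrightarrow>
     (\<forall>(x :: nat \<Rightarrow> 'v) \<sigma>. \<sigma> permutes {1, 2, 3} \<longrightarrow>
        f (x (\<sigma> 1)) (x (\<sigma> 2)) (x (\<sigma> 3)) = scale (of_int (sign \<sigma>)) (f (x 1) (x 2) (x 3)))"

text \<open>
  The scalars form an arbitrary commutative ring, so that the same notion serves for
  vector spaces over a field \<open>K\<close> and for modules over \<open>K[[t]]\<close>.
\<close>

locale ternary_hom_nambu_lie_algebra = module scale
  for scale :: "'k::comm_ring_1 \<Rightarrow> 'v::ab_group_add \<Rightarrow> 'v" +
  fixes br :: "'v \<Rightarrow> 'v \<Rightarrow> 'v \<Rightarrow> 'v" and \<alpha> \<beta> :: "'v \<Rightarrow> 'v"
  assumes linear_\<alpha>: "module_hom scale scale \<alpha>"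
    and linear_\<beta>: "module_hom scale scale \<beta>"
    and trilinear: "trilinear_on scale br"
    and skew_symmetric: "skew_symmetric_on scale br"
    and hom_nambu_identity:
      "br (\<alpha> x1) (\<beta> x2) (br x3 x4 x5) =
         br (br x1 x2 x3) (\<alpha> x4) (\<beta> x5)
         + br (\<alpha> x3) (br x1 x2 x4) (\<beta> x5)
         + br (\<alpha> x3) (\<beta> x4) (br x1 x2 x5)"


section \<open>One-parameter formal deformations\<close>

text \<open>
  \<open>V[[t]]\<close> is the type \<open>'v fps\<close>, with the \<open>K[[t]]\<close>-module structure given by the Cauchy product.
\<close>

definition fps_scale ::
    "('k::comm_ring_1 \<Rightarrow> 'v::ab_group_add \<Rightarrow> 'v) \<Rightarrow> 'k fps \<Rightarrow> 'v fps \<Rightarrow> 'v fps" where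
  "fps_scale scale c v = Abs_fps (\<lambda>n. \<Sum>i\<le>n. scale (fps_nth c i) (fps_nth v (n - i)))"

text \<open>
  Homogeneous extensions to \<open>V[[t]]\<close>:
  \<open>f (\<Sum>\<^sub>j x\<^sub>j t\<^sup>j) = \<Sum>\<^sub>j f (x\<^sub>j) t\<^sup>j\<close> for linear \<open>f\<close>, and
  \<open>f (\<Sum>\<^sub>j x\<^sub>j t\<^sup>j) (\<Sum>\<^sub>k y\<^sub>k t\<^sup>k) (\<Sum>\<^sub>l w\<^sub>l t\<^sup>l) = \<Sum>\<^sub>j\<^sub>k\<^sub>l f (x\<^sub>j) (y\<^sub>k) (w\<^sub>l) t\<^sup>j\<^sup>+\<^sup>k\<^sup>+\<^sup>l\<close> for trilinear \<open>f\<close>.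
\<close>

definition hom_ext :: "('v::ab_group_add \<Rightarrow> 'v) \<Rightarrow> 'v fps \<Rightarrow> 'v fps" where
  "hom_ext f x = Abs_fps (\<lambda>n. f (fps_nth x n))"

definition hom_ext3 ::
    "('v::ab_group_add \<Rightarrow> 'v \<Rightarrow> 'v \<Rightarrow> 'v) \<Rightarrow> 'v fps \<Rightarrow> 'v fps \<Rightarrow> 'v fps \<Rightarrow> 'v fps" where
  "hom_ext3 f x y w = Abs_fps (\<lambda>n. \<Sum>j\<le>n. \<Sum>k\<le>n - j.
     f (fps_nth x j) (fps_nth y k) (fps_nth w (n - j - k)))"

text \<open>The maps \<open>\<Sum>\<^sub>i A\<^sub>i t\<^sup>i\<close> and \<open>\<Sum>\<^sub>i B\<^sub>i t\<^sup>i\<close> on \<open>V[[t]]\<close>.\<close>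

definition formal_map :: "(nat \<Rightarrow> 'v::ab_group_add \<Rightarrow> 'v) \<Rightarrow> 'v fps \<Rightarrow> 'v fps" where
  "formal_map A x = Abs_fps (\<lambda>n. \<Sum>i\<le>n. fps_nth (hom_ext (A i) x) (n - i))"

definition formal_bracket ::
    "(nat \<Rightarrow> 'v::ab_group_add \<Rightarrow> 'v \<Rightarrow> 'v \<Rightarrow> 'v) \<Rightarrow> 'v fps \<Rightarrow> 'v fps \<Rightarrow> 'v fps \<Rightarrow> 'v fps" where
  "formal_bracket B x y w = Abs_fps (\<lambda>n. \<Sum>i\<le>n. fps_nth (hom_ext3 (B i) x y w) (n - i))"

definition formal_deformation ::
    "('k::field_char_0 \<Rightarrow> 'v::ab_group_add \<Rightarrow> 'v) \<Rightarrow>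
     ('v \<Rightarrow> 'v \<Rightarrow> 'v \<Rightarrow> 'v) \<Rightarrow> ('v \<Rightarrow> 'v) \<Rightarrow> ('v \<Rightarrow> 'v) \<Rightarrow>
     (nat \<Rightarrow> 'v \<Rightarrow> 'v \<Rightarrow> 'v \<Rightarrow> 'v) \<Rightarrow> (nat \<Rightarrow> 'v \<Rightarrow> 'v) \<Rightarrow> (nat \<Rightarrow> 'v \<Rightarrow> 'v) \<Rightarrow> bool" where
  "formal_deformation scale br0 \<alpha>0 \<beta>0 br \<alpha> \<beta> \<longleftrightarrow>
     ternary_hom_nambu_lie_algebra scale br0 \<alpha>0 \<beta>0 \<and>
     (\<forall>i. trilinear_on scale (br i)) \<and>
     (\<forall>i. module_hom scale scale (\<alpha> i)) \<and>
     (\<forall>i. module_hom scale scale (\<beta> i)) \<and>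
     br 0 = br0 \<and> \<alpha> 0 = \<alpha>0 \<and> \<beta> 0 = \<beta>0 \<and>
     ternary_hom_nambu_lie_algebra (fps_scale scale)
       (formal_bracket br) (formal_map \<alpha>) (formal_map \<beta>)"


section \<open>The ternary Virasoro-Witt algebra and its \<open>q\<close>-analogue\<close>

text \<open>
  The generators are only required to span \<open>W\<close>; the usual case of a basis is included.
\<close>

locale virasoro_witt = vector_space scale
  for scale :: "complex \<Rightarrow> 'w::ab_group_add \<Rightarrow> 'w" +
  fixes Q R :: "int \<Rightarrow> 'w" and z :: complex and br :: "'w \<Rightarrow> 'w \<Rightarrow> 'w \<Rightarrow> 'w"
  assumes generating: "span (range Q \<union> range R) = UNIV"
    and trilinear: "trilinear_on scale br"
    and skew_symmetric: "skew_symmetric_on scale br"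
    and br_QQQ: "br (Q k) (Q m) (Q n) = scale (of_int ((k - m) * (m - n) * (k - n))) (R (k + m + n))"
    and br_QQR: "br (Q k) (Q m) (R n) =
      scale (of_int (k - m)) (Q (k + m + n) + scale (z * of_int n) (R (k + m + n)))"
    and br_QRR: "br (Q k) (R m) (R n) = scale (of_int (n - m)) (R (k + m + n))"
    and br_RRR: "br (R k) (R m) (R n) = 0"

text \<open>
  \<open>\<rho>\<close> is the twisting map for the scalar \<open>q\<close>. The scalars need not be complex numbers, since
  \<open>q\<close> is also taken to be the unit \<open>1 + t\<close> of \<open>\<complex>[[t]]\<close>.
\<close>

definition q_twist ::
    "('k::{comm_ring_1, inverse} \<Rightarrow> 'v::ab_group_add \<Rightarrow> 'v) \<Rightarrow> (int \<Rightarrow> 'v) \<Rightarrow> (int \<Rightarrow> 'v) \<Rightarrow>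
     'k \<Rightarrow> ('v \<Rightarrow> 'v) \<Rightarrow> bool" where
  "q_twist scale Q R q \<rho> \<longleftrightarrow>
     module_hom scale scale \<rho> \<and>
     (\<forall>n. \<rho> (Q n) = scale (q powi n) (Q n)) \<and>
     (\<forall>n. \<rho> (R n) = scale (q powi n) (R n))"

definition q_bracket :: "('v \<Rightarrow> 'v) \<Rightarrow> ('v \<Rightarrow> 'v \<Rightarrow> 'v \<Rightarrow> 'v) \<Rightarrow> 'v \<Rightarrow> 'v \<Rightarrow> 'v \<Rightarrow> 'v" where
  "q_bracket \<rho> br x y w = \<rho> (br x y w)"

text \<open>
  The maps \<open>A\<^sub>i\<close> and \<open>B\<^sub>i\<close> are the coefficients of the \<open>q\<close>-algebras, with twisting maps \<open>\<rho> q\<close>,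
  in the parameter \<open>t = q - 1\<close>: the algebra over \<open>\<complex>[[t]]\<close> they define is the \<open>q\<close>-algebra for
  \<open>q = 1 + t\<close>, and for complex \<open>q\<close> near 1 the series at \<open>t = q - 1\<close> sum to the structure maps of
  the \<open>q\<close>-algebra. As \<open>W\<close> has no topology, convergence is tested on linear functionals; for fixed
  arguments all terms lie in one finite-dimensional subspace.
\<close>

definition q_expansion ::
    "(complex \<Rightarrow> 'w::ab_group_add \<Rightarrow> 'w) \<Rightarrow> (int \<Rightarrow> 'w) \<Rightarrow> (int \<Rightarrow> 'w) \<Rightarrow>
     ('w \<Rightarrow> 'w \<Rightarrow> 'w \<Rightarrow> 'w) \<Rightarrow> (complex \<Rightarrow> 'w \<Rightarrow> 'w) \<Rightarrow>
     (nat \<Rightarrow> 'w \<Rightarrow> 'w \<Rightarrow> 'w \<Rightarrow> 'w) \<Rightarrow> (nat \<Rightarrow> 'w \<Rightarrow> 'w) \<Rightarrow> bool" where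
  "q_expansion scale Q R br \<rho> B A \<longleftrightarrow>
     q_twist (fps_scale scale) (\<lambda>n. fps_const (Q n)) (\<lambda>n. fps_const (R n))
       (1 + fps_X) (formal_map A) \<and>
     formal_bracket B = q_bracket (formal_map A) (hom_ext3 br) \<and>
     (\<forall>q f. norm (q - 1) < 1 \<longrightarrow> module_hom scale (*) f \<longrightarrow>
        (\<forall>x. (\<lambda>i. f (A i x) * (q - 1) ^ i) sums f (\<rho> q x)) \<and>
        (\<forall>x y w. (\<lambda>i. f (B i x y w) * (q - 1) ^ i) sums f (q_bracket (\<rho> q) br x y w)))"

end

theory Submission
  imports Defs "HOL-Analysis.Generalised_Binomial_Theorem"
begin

text \<open>
  The eigenvectors of \<open>\<rho>\<^sub>2\<close> grade \<open>W\<close>, with \<open>Q\<^sub>n\<close> and \<open>R\<^sub>n\<close> in degree \<open>n\<close>, and the bracket respects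
  degrees. Let \<open>A\<^sub>i\<close> multiply by the binomial coefficient of \<open>n\<close> over \<open>i\<close> in degree \<open>n\<close>, and let \<open>B\<^sub>i\<close>
  be \<open>A\<^sub>i\<close> after the bracket. Then \<open>\<Sum>\<^sub>i A\<^sub>i t\<^sup>i\<close> acts as \<open>(1 + t)\<^sup>n\<close> in degree \<open>n\<close>, hence is an endomorphism
  of the bracket extended to \<open>W[[t]]\<close>. Twisting a Nambu-Lie algebra by an endomorphism gives a
  hom-Nambu-Lie algebra. The Nambu identity itself holds on generators because \<open>z\<^sup>2 = -4\<close>, and it
  extends to \<open>W[[t]]\<close> because \<open>K[[t]]\<close>-linear maps on \<open>W[[t]]\<close> are determined by the constants.
\<close>

section \<open>Multilinear maps over a commutative ring\<close>

lemma trilinear_onD: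
  assumes "trilinear_on s f"
  shows "f (x + x') y w = f x y w + f x' y w" "f (s c x) y w = s c (f x y w)"
    and "f x (y + y') w = f x y w + f x y' w" "f x (s c y) w = s c (f x y w)"
    and "f x y (w + w') = f x y w + f x y w'" "f x y (s c w) = s c (f x y w)"
  using assms by (auto simp: trilinear_on_def module_hom_iff)

lemma trilinear_on_module_hom:
  assumes "trilinear_on s f"
  shows "module_hom s s (\<lambda>x. f x y w)" "module_hom s s (\<lambda>y. f x y w)"
    and "module_hom s s (\<lambda>w. f x y w)"
  using assms by (auto simp: trilinear_on_def)

section \<open>Skew-symmetry in terms of adjacent transpositions\<close>

context module
begin

lemma skew_symmetric_onD:
  assumes "skew_symmetric_on scale f"
  shows "f y x w = - f x y w" "f x w y = - f x y w"
proof -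
  let ?x = "\<lambda>i::nat. if i = 1 then x else if i = 2 then y else w"
  have perm: "Transposition.transpose (1::nat) 2 permutes {1, 2, 3}"
    "Transposition.transpose (2::nat) 3 permutes {1, 2, 3}"
    by (auto intro: permutes_swap_id)
  show "f y x w = - f x y w"
    using assms perm(1) unfolding skew_symmetric_on_def
    by (auto dest!: spec[of _ ?x] spec[of _ "Transposition.transpose (1::nat) 2"]
        simp: sign_swap_id transpose_def)
  show "f x w y = - f x y w"
    using assms perm(2) unfolding skew_symmetric_on_def
    by (auto dest!: spec[of _ ?x] spec[of _ "Transposition.transpose (2::nat) 3"]
        simp: sign_swap_id transpose_def)
qed

text \<open>The transpositions (1 2) and (2 3) generate the symmetric group on three letters. The
  sign rule for (1 3) comes from three adjacent swaps, and an arbitrary permutation is reached by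
  induction, one transposition at a time.\<close>

lemma skew_symmetric_onI:
  assumes s12: "\<And>x y w. f y x w = - f x y w" and s23: "\<And>x y w. f x w y = - f x y w"
  shows "skew_symmetric_on scale f"
  unfolding skew_symmetric_on_def
proof (intro allI impI)
  fix x :: "nat \<Rightarrow> 'b" and \<sigma> :: "nat \<Rightarrow> nat"
  assume \<sigma>: "\<sigma> permutes {1, 2, 3}"
  have s13: "f w y x = - f x y w" for x y w
    using s12[of y w x] s23[of y x w] s12[of x y w] by simp
  have "finite {1, 2, 3::nat}" by simp
  with \<sigma> show "f (x (\<sigma> 1)) (x (\<sigma> 2)) (x (\<sigma> 3)) = scale (of_int (sign \<sigma>)) (f (x 1) (x 2) (x 3))"
  proof (induction arbitrary: x rule: permutes_induct)
    case id
    then show ?case by simp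
  next
    case (swap a b p)
    have "permutation p"
      using swap.hyps permutes_imp_permutation[of "{1, 2, 3}" p] by simp
    then have sgn: "sign (Transposition.transpose a b \<circ> p) = - sign p"
      using swap.hyps by (simp add: sign_compose permutation_swap_id sign_swap_id)
    \<comment> \<open>The transposition is composed on the outside of \<open>p\<close>, so it can be
      absorbed into the family of arguments. The induction hypothesis is then applied to the
      permuted family, which is why \<open>x\<close> is arbitrary.\<close>
    let ?y = "x \<circ> Transposition.transpose a b"
    have "f (?y 1) (?y 2) (?y 3) = - f (x 1) (x 2) (x 3)"
      using swap.hyps
      by (auto simp: transpose_def s12[where x = "x 1" and y = "x 2"] s23[where y = "x 2" and w = "x 3"]
          s13[where x = "x 1" and w = "x 3"] simp del: One_nat_def)
    moreover have "f (x ((Transposition.transpose a b \<circ> p) 1)) (x ((Transposition.transpose a b \<circ> p) 2))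
        (x ((Transposition.transpose a b \<circ> p) 3)) = scale (of_int (sign p)) (f (?y 1) (?y 2) (?y 3))"
      using swap.IH[of ?y] by simp
    ultimately show ?case
      by (simp only: sgn of_int_minus scale_minus_left scale_minus_right)
  qed
qed

end

text \<open>Weaker than spanning: for infinite-dimensional \<open>W\<close> the constants do not
  span \<open>W[[t]]\<close> over \<open>K[[t]]\<close>, but they still determine every linear
  endomorphism. The notion covers \<open>W\<close> and \<open>W[[t]]\<close> alike.\<close>

definition determining_set ::
    "('k::comm_ring_1 \<Rightarrow> 'v::ab_group_add \<Rightarrow> 'v) \<Rightarrow> 'v set \<Rightarrow> bool" where
  "determining_set s G \<longleftrightarrow>
     (\<forall>f x. module_hom s s f \<longrightarrow> (\<forall>g\<in>G. f g = 0) \<longrightarrow> f x = 0)"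

lemma determining_set_eqI:
  assumes G: "determining_set s G"
    and f: "module_hom s s f" and g: "module_hom s s g"
    and eq: "\<And>x. x \<in> G \<Longrightarrow> f x = g x"
  shows "f x = g x"
proof -
  interpret f: module_hom s s f by (rule f)
  interpret module_pair s s by unfold_locales
  have "module_hom s s (\<lambda>x. f x - g x)"
    by (rule module_hom_sub[OF f g])
  then have "f x - g x = 0"
    using G eq unfolding determining_set_def by fastforce
  then show ?thesis by simp
qed

lemma trilinear_on_eqI:
  assumes G: "determining_set s G"
    and f: "trilinear_on s f" and g: "trilinear_on s g"
    and eq: "\<And>x y w. x \<in> G \<Longrightarrow> y \<in> G \<Longrightarrow> w \<in> G \<Longrightarrow> f x y w = g x y w"
  shows "f x y w = g x y w"
proof -
  note homs = trilinear_on_module_hom[OF f] trilinear_on_module_hom[OF g]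
  have "f x y w = g x y w" if "y \<in> G" "w \<in> G" for x y w
    by (rule determining_set_eqI[OF G homs(1,4)]) (use eq that in auto)
  then have "f x y w = g x y w" if "w \<in> G" for x y w
    by (rule determining_set_eqI[OF G homs(2,5)]) (use that in auto)
  then show ?thesis
    by (rule determining_set_eqI[OF G homs(3,6)])
qed

definition nambu_identity_at :: "('v::ab_group_add \<Rightarrow> 'v \<Rightarrow> 'v \<Rightarrow> 'v) \<Rightarrow> 'v \<Rightarrow> 'v \<Rightarrow> 'v \<Rightarrow> 'v \<Rightarrow> 'v \<Rightarrow> bool"
  where "nambu_identity_at br x1 x2 x3 x4 x5 \<longleftrightarrow>
    br x1 x2 (br x3 x4 x5) = br (br x1 x2 x3) x4 x5 + br x3 (br x1 x2 x4) x5 + br x3 x4 (br x1 x2 x5)"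

text \<open>Both sides are linear in each of the five arguments, so the restriction to
  \<open>G\<close> can be lifted from one argument after another.\<close>

lemma nambu_identityI:
  assumes G: "determining_set s G" and tri: "trilinear_on s br"
    and eq: "\<And>x1 x2 x3 x4 x5. x1 \<in> G \<Longrightarrow> x2 \<in> G \<Longrightarrow> x3 \<in> G \<Longrightarrow> x4 \<in> G \<Longrightarrow> x5 \<in> G \<Longrightarrow>
      nambu_identity_at br x1 x2 x3 x4 x5"
  shows "nambu_identity_at br x1 x2 x3 x4 x5"
proof -
  define L where "L x1 x2 x3 x4 x5 = br x1 x2 (br x3 x4 x5)" for x1 x2 x3 x4 x5
  define R where "R x1 x2 x3 x4 x5 =
    br (br x1 x2 x3) x4 x5 + br x3 (br x1 x2 x4) x5 + br x3 x4 (br x1 x2 x5)" for x1 x2 x3 x4 x5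
  interpret module s
    using trilinear_on_module_hom(1)[OF tri] by (simp add: module_hom_iff)
  note lin = trilinear_onD[OF tri] scale_right_distrib module_axioms
  have L: "module_hom s s (\<lambda>x. L x x2 x3 x4 x5)" "module_hom s s (\<lambda>x. L x1 x x3 x4 x5)"
    "module_hom s s (\<lambda>x. L x1 x2 x x4 x5)" "module_hom s s (\<lambda>x. L x1 x2 x3 x x5)"
    "module_hom s s (\<lambda>x. L x1 x2 x3 x4 x)" for x1 x2 x3 x4 x5
    by (auto simp: L_def module_hom_iff lin)
  have R: "module_hom s s (\<lambda>x. R x x2 x3 x4 x5)" "module_hom s s (\<lambda>x. R x1 x x3 x4 x5)"
    "module_hom s s (\<lambda>x. R x1 x2 x x4 x5)" "module_hom s s (\<lambda>x. R x1 x2 x3 x x5)"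
    "module_hom s s (\<lambda>x. R x1 x2 x3 x4 x)" for x1 x2 x3 x4 x5
    by (auto simp: R_def module_hom_iff lin)
  have "L x1 x2 x3 x4 x5 = R x1 x2 x3 x4 x5"
    if "x1 \<in> G" "x2 \<in> G" "x3 \<in> G" "x4 \<in> G" "x5 \<in> G" for x1 x2 x3 x4 x5
    using eq[OF that] by (simp add: nambu_identity_at_def L_def R_def)
  then have "L x1 x2 x3 x4 x5 = R x1 x2 x3 x4 x5"
    if "x2 \<in> G" "x3 \<in> G" "x4 \<in> G" "x5 \<in> G" for x1 x2 x3 x4 x5
    by (rule determining_set_eqI[OF G L(1) R(1)]) (use that in auto)
  then have "L x1 x2 x3 x4 x5 = R x1 x2 x3 x4 x5"
    if "x3 \<in> G" "x4 \<in> G" "x5 \<in> G" for x1 x2 x3 x4 x5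
    by (rule determining_set_eqI[OF G L(2) R(2)]) (use that in auto)
  then have "L x1 x2 x3 x4 x5 = R x1 x2 x3 x4 x5" if "x4 \<in> G" "x5 \<in> G" for x1 x2 x3 x4 x5
    by (rule determining_set_eqI[OF G L(3) R(3)]) (use that in auto)
  then have "L x1 x2 x3 x4 x5 = R x1 x2 x3 x4 x5" if "x5 \<in> G" for x1 x2 x3 x4 x5
    by (rule determining_set_eqI[OF G L(4) R(4)]) (use that in auto)
  then have "L x1 x2 x3 x4 x5 = R x1 x2 x3 x4 x5"
    by (rule determining_set_eqI[OF G L(5) R(5)])
  then show ?thesis by (simp add: nambu_identity_at_def L_def R_def)
qed

text \<open>As \<open>\<rho>\<close> commutes with the bracket, each side of the hom-Nambu identity
  is \<open>\<rho> \<circ> \<rho>\<close> applied to the corresponding side of the Nambu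
  identity.\<close>

lemma yau_twist:
  assumes tri: "trilinear_on s br" and skew: "skew_symmetric_on s br"
    and nambu: "\<And>x1 x2 x3 x4 x5. nambu_identity_at br x1 x2 x3 x4 x5"
    and lin: "module_hom s s \<rho>"
    and mult: "\<And>x y w. \<rho> (br x y w) = br (\<rho> x) (\<rho> y) (\<rho> w)"
  shows "ternary_hom_nambu_lie_algebra s (q_bracket \<rho> br) \<rho> \<rho>"
proof -
  interpret \<rho>: module_hom s s \<rho> by (rule lin)
  show ?thesis
  proof unfold_locales
    show "trilinear_on s (q_bracket \<rho> br)"
      unfolding trilinear_on_def q_bracket_def
      by (auto simp: module_hom_iff trilinear_onD[OF tri] \<rho>.add \<rho>.scale \<rho>.m1.module_axioms)
    show "skew_symmetric_on s (q_bracket \<rho> br)"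
      unfolding q_bracket_def
      by (intro \<rho>.m1.skew_symmetric_onI; subst \<rho>.neg[symmetric])
        (rule arg_cong[where f = \<rho>], rule \<rho>.m1.skew_symmetric_onD[OF skew])+
    fix x1 x2 x3 x4 x5
    have "q_bracket \<rho> br (\<rho> x1) (\<rho> x2) (q_bracket \<rho> br x3 x4 x5) = \<rho> (\<rho> (br x1 x2 (br x3 x4 x5)))"
      by (simp add: q_bracket_def mult)
    also have "\<dots> = \<rho> (\<rho> (br (br x1 x2 x3) x4 x5 + br x3 (br x1 x2 x4) x5 + br x3 x4 (br x1 x2 x5)))"
      using nambu[of x1 x2 x3 x4 x5] by (simp add: nambu_identity_at_def)
    also have "\<dots> = q_bracket \<rho> br (q_bracket \<rho> br x1 x2 x3) (\<rho> x4) (\<rho> x5)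
         + q_bracket \<rho> br (\<rho> x3) (q_bracket \<rho> br x1 x2 x4) (\<rho> x5)
         + q_bracket \<rho> br (\<rho> x3) (\<rho> x4) (q_bracket \<rho> br x1 x2 x5)"
      by (simp add: q_bracket_def \<rho>.add mult)
    finally show "q_bracket \<rho> br (\<rho> x1) (\<rho> x2) (q_bracket \<rho> br x3 x4 x5) =
      q_bracket \<rho> br (q_bracket \<rho> br x1 x2 x3) (\<rho> x4) (\<rho> x5)
         + q_bracket \<rho> br (\<rho> x3) (q_bracket \<rho> br x1 x2 x4) (\<rho> x5)
         + q_bracket \<rho> br (\<rho> x3) (\<rho> x4) (q_bracket \<rho> br x1 x2 x5)" .
  qed
qed

text \<open>A basis of eigenvectors is extracted from \<open>S\<close> and \<open>D\<close> is
  prescribed there. Since \<open>c\<close> is injective, eigenvectors of \<open>\<rho>\<close> for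
  \<open>c n\<close> only involve basis vectors with that same eigenvalue, so \<open>D\<close> acts
  by \<open>g n\<close> on the whole eigenspace and not just on the chosen basis.\<close>

lemma (in vector_space) exists_diagonal:
  fixes c :: "'i \<Rightarrow> 'a"
  assumes lin: "module_hom scale scale \<rho>" and "inj c" and S: "span S = UNIV"
    and eig: "\<And>s. s \<in> S \<Longrightarrow> \<exists>n. \<rho> s = scale (c n) s"
  obtains D where "module_hom scale scale D"
    and "\<And>n v. \<rho> v = scale (c n) v \<Longrightarrow> D v = scale (g n) v"
proof -
  interpret vector_space_pair scale scale by unfold_locales
  interpret \<rho>: module_hom scale scale \<rho> by (rule lin)
  obtain B where B: "B \<subseteq> S" "independent B" "S \<subseteq> span B"
    using maximal_independent_subset[of S] by blast
  have span_B: "v \<in> span B" for v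
    using S B(3) span_mono[of S "span B"] by (auto simp: span_span)
  define d where "d b = (SOME n. \<rho> b = scale (c n) b)" for b
  have d: "\<rho> b = scale (c (d b)) b" if "b \<in> B" for b
    unfolding d_def by (rule someI_ex) (use that B(1) eig in auto)
  obtain D where D: "Vector_Spaces.linear scale scale D" "\<And>b. b \<in> B \<Longrightarrow> D b = scale (g (d b)) b"
    using linear_independent_extend[OF B(2), of "\<lambda>b. scale (g (d b)) b"] by auto
  interpret D: Vector_Spaces.linear scale scale D by (rule D(1))
  have "D v = scale (g n) v" if v: "\<rho> v = scale (c n) v" for n v
  proof -
    obtain t r where t: "finite t" "t \<subseteq> B" "v = (\<Sum>a\<in>t. scale (r a) a)"
      using span_B[of v] unfolding span_explicit by auto
    \<comment> \<open>Independence of the basis turns this vanishing combination into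
      \<open>r a = 0\<close> for every basis vector whose index \<open>d a\<close> differs from
      \<open>n\<close>.\<close>
    have "(\<Sum>a\<in>t. scale (r a * (c (d a) - c n)) a) = \<rho> v - scale (c n) v"
      using t(2) unfolding t(3) \<rho>.sum scale_sum_right sum_subtractf[symmetric]
      by (intro sum.cong) (auto simp: \<rho>.scale d algebra_simps scale_left_diff_distrib)
    also have "\<dots> = 0" using v by simp
    finally have "r a * (c (d a) - c n) = 0" if "a \<in> t" for a
      using independentD[OF B(2) t(1,2), of "\<lambda>a. r a * (c (d a) - c n)"] that by simp
    then have "r a = 0 \<or> d a = n" if "a \<in> t" for a
      using that \<open>inj c\<close> by (auto dest: injD)
    moreover have "D a = scale (g (d a)) a" if "a \<in> t" for a
      using that t(2) D(2) by auto
    ultimately show ?thesis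
      unfolding t(3) D.sum scale_sum_right
      by (intro sum.cong) (force simp: D.scale mult.commute)+
  qed
  then show thesis
    using that D(1) by (simp add: module_hom_iff_linear)
qed


section \<open>The module of formal power series\<close>

lemma fps_scale_nth: "fps_nth (fps_scale s c v) n = (\<Sum>i\<le>n. s (fps_nth c i) (fps_nth v (n - i)))"
  by (simp add: fps_scale_def)

lemma hom_ext3_nth: "fps_nth (hom_ext3 f x y w) n =
    (\<Sum>j\<le>n. \<Sum>k\<le>n - j. f (fps_nth x j) (fps_nth y k) (fps_nth w (n - j - k)))"
  by (simp add: hom_ext3_def)

lemma formal_map_nth: "fps_nth (formal_map A x) n = (\<Sum>i\<le>n. A i (fps_nth x (n - i)))"
  by (simp add: formal_map_def hom_ext_def)

text \<open>Two ways of summing over all triples of total \<open>n\<close>. This gives associativity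
  of the \<open>K[[t]]\<close>-action and the compatibility of \<open>hom_ext3\<close> with
  scalars.\<close>

lemma sum_convolution_assoc:
  fixes g :: "nat \<Rightarrow> nat \<Rightarrow> nat \<Rightarrow> 'a::comm_monoid_add"
  shows "(\<Sum>j\<le>n. \<Sum>i\<le>j. g i (j - i) (n - j)) = (\<Sum>i\<le>n. \<Sum>j\<le>n - i. g i j (n - i - j))"
  using fps_mult_assoc_lemma[of g n n] by (simp add: atLeast0AtMost)

lemma sum_triangle_swap:
  fixes g :: "nat \<Rightarrow> nat \<Rightarrow> 'a::comm_monoid_add"
  shows "(\<Sum>i\<le>n. \<Sum>j\<le>n - i. g i j) = (\<Sum>j\<le>n. \<Sum>i\<le>n - j. g i j)"
  unfolding sum.Sigma[OF finite_atMost ballI[OF finite_atMost]]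
  by (rule sum.reindex_bij_witness[of _ prod.swap prod.swap]) auto

context module
begin

lemma module_fps: "module (fps_scale scale)"
proof
  fix a b :: "'a fps" and x y :: "'b fps"
  show "fps_scale scale a (x + y) = fps_scale scale a x + fps_scale scale a y"
    by (simp add: fps_eq_iff fps_scale_nth scale_right_distrib sum.distrib)
  show "fps_scale scale (a + b) x = fps_scale scale a x + fps_scale scale b x"
    by (simp add: fps_eq_iff fps_scale_nth scale_left_distrib sum.distrib)
  show "fps_scale scale 1 x = x"
    by (simp add: fps_eq_iff fps_scale_nth if_distrib[of "\<lambda>c. scale c _"] cong: if_cong)
  show "fps_scale scale a (fps_scale scale b x) = fps_scale scale (a * b) x"
  proof (rule fps_ext)
    fix n
    have "fps_nth (fps_scale scale (a * b) x) n =
        (\<Sum>j\<le>n. \<Sum>i\<le>j. scale (fps_nth a i * fps_nth b (j - i)) (fps_nth x (n - j)))"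
      by (simp add: fps_scale_nth fps_mult_nth atLeast0AtMost scale_sum_left)
    also have "\<dots> = (\<Sum>i\<le>n. \<Sum>j\<le>n - i. scale (fps_nth a i * fps_nth b j) (fps_nth x (n - i - j)))"
      by (rule sum_convolution_assoc)
    finally show "fps_nth (fps_scale scale a (fps_scale scale b x)) n = fps_nth (fps_scale scale (a * b) x) n"
      by (simp add: fps_scale_nth scale_sum_right)
  qed
qed

lemma fps_scale_fps_const_right: "fps_scale scale c (fps_const v) = Abs_fps (\<lambda>n. scale (fps_nth c n) v)"
proof (rule fps_ext)
  fix n
  have "fps_nth (fps_scale scale c (fps_const v)) n = (\<Sum>i\<in>{n}. scale (fps_nth c i) v)"
    unfolding fps_scale_nth by (rule sum.mono_neutral_cong_right) auto
  then show "fps_nth (fps_scale scale c (fps_const v)) n = fps_nth (Abs_fps (\<lambda>n. scale (fps_nth c n) v)) n"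
    by simp
qed

lemma fps_scale_X_nth: "fps_nth (fps_scale scale fps_X y) n = (if n = 0 then 0 else fps_nth y (n - 1))"
proof -
  have "fps_nth (fps_scale scale fps_X y) n = (\<Sum>i\<in>(if n = 0 then {} else {1}). fps_nth y (n - i))"
    unfolding fps_scale_nth by (rule sum.mono_neutral_cong_right) (auto simp: fps_X_def split: if_splits)
  then show ?thesis by simp
qed

lemma fps_decompose: "x = fps_const (fps_nth x 0) + fps_scale scale fps_X (fps_shift 1 x)"
  by (rule fps_ext) (simp add: fps_scale_X_nth)

lemma determining_set_span:
  assumes "span G = UNIV"
  shows "determining_set scale G"
  unfolding determining_set_def
proof (intro allI impI)
  fix f x assume f: "module_hom scale scale f" "\<forall>g\<in>G. f g = 0"
  interpret module_pair scale scale by unfold_locales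
  show "f x = 0"
    by (rule module_hom_eq_on_span[OF f(1) module_hom_zero, of G]) (use f assms in auto)
qed

text \<open>Linearity over \<open>K[[t]]\<close> forces continuity: \<open>F\<close> vanishes on constants, so
  \<open>F x = t F x'\<close> for the shifted series \<open>x'\<close>.\<close>

lemma determining_set_fps:
  assumes "span G = UNIV"
  shows "determining_set (fps_scale scale) (fps_const ` G)"
  unfolding determining_set_def
proof (intro allI impI)
  fix F x assume F: "module_hom (fps_scale scale) (fps_scale scale) F" "\<forall>g\<in>fps_const ` G. F g = 0"
  interpret F: module_hom "fps_scale scale" "fps_scale scale" F by (rule F(1))
  have const: "F (fps_const v) = 0" for v
  proof -
    have "subspace {v. F (fps_const v) = 0}"
    proof (rule subspaceI)
      show "0 \<in> {v. F (fps_const v) = 0}"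
        by (simp add: F.zero)
      show "x + y \<in> {v. F (fps_const v) = 0}"
        if "x \<in> {v. F (fps_const v) = 0}" "y \<in> {v. F (fps_const v) = 0}" for x y
        using that F.add[of "fps_const x" "fps_const y"] by simp
      show "scale c x \<in> {v. F (fps_const v) = 0}" if "x \<in> {v. F (fps_const v) = 0}" for c x
      proof -
        \<comment> \<open>Constant series embed \<open>K\<close> in \<open>K[[t]]\<close>, so
          linearity over \<open>K[[t]]\<close> restricts to linearity over \<open>K\<close> on
          constants.\<close>
        have "fps_const (scale c x) = fps_scale scale (fps_const c) (fps_const x)"
          by (auto simp: fps_scale_fps_const_right fps_eq_iff)
        then show ?thesis using that F.scale by simp
      qed
    qed
    then have "span G \<subseteq> {v. F (fps_const v) = 0}"
      using F(2) by (intro span_minimal) auto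
    then show ?thesis using assms by auto
  qed
  have step: "F x = fps_scale scale fps_X (F (fps_shift 1 x))" for x
    by (subst fps_decompose) (simp only: F.add F.scale const add_0)
  \<comment> \<open>By \<open>step\<close>, coefficient \<open>n + 1\<close> of \<open>F x\<close>
    is coefficient \<open>n\<close> of \<open>F\<close> at the shifted series, so the induction must
    range over all \<open>x\<close>.\<close>
  have "fps_nth (F x) n = 0" for n
  proof (induction n arbitrary: x)
    case 0
    then show ?case by (subst step) (simp add: fps_scale_X_nth)
  next
    case (Suc n)
    then show ?case by (subst step) (simp add: fps_scale_X_nth)
  qed
  then show "F x = 0" by (simp add: fps_eq_iff)
qed

section \<open>Extensions of linear and trilinear maps to formal power series\<close>

lemma module_hom_formal_map:
  assumes A: "\<And>i. module_hom scale scale (A i)"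
  shows "module_hom (fps_scale scale) (fps_scale scale) (formal_map A)"
  unfolding module_hom_iff
proof (intro conjI allI module_fps)
  fix x y c
  show "formal_map A (x + y) = formal_map A x + formal_map A y"
    by (simp add: fps_eq_iff formal_map_nth module_hom.add[OF A] sum.distrib)
  show "formal_map A (fps_scale scale c x) = fps_scale scale c (formal_map A x)"
  proof (rule fps_ext)
    fix n
    have "fps_nth (formal_map A (fps_scale scale c x)) n =
        (\<Sum>i\<le>n. \<Sum>j\<le>n - i. scale (fps_nth c j) (A i (fps_nth x (n - i - j))))"
      by (simp add: formal_map_nth fps_scale_nth module_hom.sum[OF A] module_hom.scale[OF A])
    also have "\<dots> = (\<Sum>j\<le>n. \<Sum>i\<le>n - j. scale (fps_nth c j) (A i (fps_nth x (n - i - j))))"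
      by (rule sum_triangle_swap)
    finally show "fps_nth (formal_map A (fps_scale scale c x)) n = fps_nth (fps_scale scale c (formal_map A x)) n"
      by (simp add: formal_map_nth fps_scale_nth scale_sum_right add.commute)
  qed
qed

lemma formal_map_fps_const:
  assumes A: "\<And>i. module_hom scale scale (A i)"
  shows "formal_map A (fps_const v) = Abs_fps (\<lambda>i. A i v)"
proof (rule fps_ext)
  fix n
  have "fps_nth (formal_map A (fps_const v)) n = (\<Sum>i\<in>{n}. A i v)"
    unfolding formal_map_nth
    by (rule sum.mono_neutral_cong_right) (auto simp: module_hom.zero[OF A])
  then show "fps_nth (formal_map A (fps_const v)) n = fps_nth (Abs_fps (\<lambda>i. A i v)) n"
    by simp
qed

text \<open>The index set is now symmetric in the three slots, so permuting arguments becomes a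
  bijection of the summation range.\<close>

lemma hom_ext3_nth_triples:
  "fps_nth (hom_ext3 f x y w) n =
    (\<Sum>(j, k, l)\<in>{(j, k, l). j + k + l = n}. f (fps_nth x j) (fps_nth y k) (fps_nth w l))"
  unfolding hom_ext3_nth sum.Sigma[OF finite_atMost ballI[OF finite_atMost]]
  by (rule sum.reindex_bij_witness[of _ "\<lambda>(j, k, l). (j, k)" "\<lambda>(j, k). (j, k, n - j - k)"]) auto

lemma skew_symmetric_hom_ext3:
  assumes "skew_symmetric_on scale f"
  shows "skew_symmetric_on (fps_scale scale) (hom_ext3 f)"
proof (rule module.skew_symmetric_onI[OF module_fps])
  note skew = skew_symmetric_onD[OF assms]
  fix x y w
  show "hom_ext3 f y x w = - hom_ext3 f x y w"
  proof (rule fps_ext)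
    fix n
    show "fps_nth (hom_ext3 f y x w) n = fps_nth (- hom_ext3 f x y w) n"
      unfolding hom_ext3_nth_triples fps_neg_nth sum_negf[symmetric]
      by (rule sum.reindex_bij_witness[of _ "\<lambda>(j, k, l). (k, j, l)" "\<lambda>(j, k, l). (k, j, l)"])
        (auto simp: skew(1)[where x = "fps_nth x a" and y = "fps_nth y b" for a b])
  qed
  show "hom_ext3 f x w y = - hom_ext3 f x y w"
  proof (rule fps_ext)
    fix n
    show "fps_nth (hom_ext3 f x w y) n = fps_nth (- hom_ext3 f x y w) n"
      unfolding hom_ext3_nth_triples fps_neg_nth sum_negf[symmetric]
      by (rule sum.reindex_bij_witness[of _ "\<lambda>(j, k, l). (j, l, k)" "\<lambda>(j, k, l). (j, l, k)"])
        (auto simp: skew(2)[where y = "fps_nth y a" and w = "fps_nth w b" for a b])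
  qed
qed

text \<open>Only the first slot needs a computation. Skew-symmetry carries linearity to the second
  slot and then to the third, up to a sign.\<close>

lemma trilinear_hom_ext3:
  assumes tri: "trilinear_on scale f" and skew: "skew_symmetric_on scale f"
  shows "trilinear_on (fps_scale scale) (hom_ext3 f)"
proof -
  interpret fps: module "fps_scale scale" by (rule module_fps)
  interpret module_pair scale scale by unfold_locales
  have hom1: "module_hom (fps_scale scale) (fps_scale scale) (\<lambda>x. hom_ext3 f x y w)" for y w
    unfolding module_hom_iff
  proof (intro conjI allI module_fps)
    fix x x' c
    show "hom_ext3 f (x + x') y w = hom_ext3 f x y w + hom_ext3 f x' y w"
      by (simp add: fps_eq_iff hom_ext3_nth trilinear_onD[OF tri] sum.distrib)
    show "hom_ext3 f (fps_scale scale c x) y w = fps_scale scale c (hom_ext3 f x y w)"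
    proof (rule fps_ext)
      fix n
      \<comment> \<open>Collecting the two fixed arguments in \<open>T\<close> leaves a single
        convolution in \<open>x\<close>, to which \<open>sum_convolution_assoc\<close>
        applies.\<close>
      define T where "T m a = (\<Sum>k\<le>m. f a (fps_nth y k) (fps_nth w (m - k)))" for m a
      have T: "module_hom scale scale (T m)" for m
        unfolding T_def by (rule module_hom_sum) (auto simp: trilinear_on_module_hom[OF tri])
      have ext: "fps_nth (hom_ext3 f x y w) n = (\<Sum>j\<le>n. T (n - j) (fps_nth x j))" for x n
        by (simp add: hom_ext3_nth T_def)
      have "fps_nth (hom_ext3 f (fps_scale scale c x) y w) n =
          (\<Sum>j\<le>n. \<Sum>i\<le>j. scale (fps_nth c i) (T (n - j) (fps_nth x (j - i))))"
        by (simp add: ext fps_scale_nth module_hom.sum[OF T] module_hom.scale[OF T])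
      also have "\<dots> = (\<Sum>i\<le>n. \<Sum>j\<le>n - i. scale (fps_nth c i) (T (n - i - j) (fps_nth x j)))"
        by (rule sum_convolution_assoc)
      finally show "fps_nth (hom_ext3 f (fps_scale scale c x) y w) n =
          fps_nth (fps_scale scale c (hom_ext3 f x y w)) n"
        by (simp add: ext fps_scale_nth scale_sum_right)
    qed
  qed
  note swap = fps.skew_symmetric_onD[OF skew_symmetric_hom_ext3[OF skew]]
  interpret fps2: module_pair "fps_scale scale" "fps_scale scale" by unfold_locales
  have hom2: "module_hom (fps_scale scale) (fps_scale scale) (\<lambda>y. hom_ext3 f x y w)" for x w
    by (subst swap(1)) (rule fps2.module_hom_neg[OF hom1])
  have hom3: "module_hom (fps_scale scale) (fps_scale scale) (\<lambda>w. hom_ext3 f x y w)" for x y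
    by (subst swap(2)) (rule fps2.module_hom_neg[OF hom2])
  show ?thesis
    using hom1 hom2 hom3 by (simp add: trilinear_on_def)
qed

lemma hom_ext3_fps_const:
  assumes tri: "trilinear_on scale f"
  shows "hom_ext3 f (fps_const x) (fps_const y) (fps_const w) = fps_const (f x y w)"
proof (rule fps_ext)
  fix n
  note zero = trilinear_on_module_hom[OF tri, THEN module_hom.zero]
  have "fps_nth (hom_ext3 f (fps_const x) (fps_const y) (fps_const w)) n =
      (\<Sum>(j, k, l)\<in>(if n = 0 then {(0 :: nat, 0 :: nat, 0 :: nat)} else {}). f x y w)"
    unfolding hom_ext3_nth_triples
  proof (rule sum.mono_neutral_cong_right)
    have "{(j, k, l). j + k + l = n} \<subseteq> {..n} \<times> {..n} \<times> {..n}" by auto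
    then show "finite {(j, k, l). j + k + l = n}" by (rule finite_subset) simp
  qed (auto simp: zero split: if_splits)
  then show "fps_nth (hom_ext3 f (fps_const x) (fps_const y) (fps_const w)) n = fps_nth (fps_const (f x y w)) n"
    by simp
qed

text \<open>Each \<open>A i\<close> is additive and passes through the finite sums of the Cauchy
  product. The deformed bracket is thereby a twist of the extended bracket, the form required by
  \<open>yau_twist\<close>.\<close>

lemma formal_bracket_eq:
  assumes A: "\<And>i. module_hom scale scale (A i)"
  shows "formal_bracket (\<lambda>i. q_bracket (A i) br) = q_bracket (formal_map A) (hom_ext3 br)"
  by (intro ext fps_ext)
    (simp add: formal_bracket_def q_bracket_def formal_map_nth hom_ext3_nth module_hom.sum[OF A])

end

text \<open>Makes the generalised binomial coefficients the coefficients of the twist for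
  \<open>q = 1 + t\<close>. Negative exponents are powers of the inverse of
  \<open>1 + fps_X\<close>, which is the binomial series for exponent -1.\<close>

lemma power_int_one_plus_fps_X:
  "(1 + fps_X :: 'a::field_char_0 fps) powi n = fps_binomial (of_int n)"
proof (cases "n \<ge> 0")
  case True
  then show ?thesis
    using fps_binomial_of_nat[of "nat n", where ?'a = 'a] by (simp add: power_int_def)
next
  case False
  have "(1 + fps_X :: 'a fps) powi n = fps_binomial (- 1) ^ nat (- n)"
    using False by (simp add: power_int_def fps_binomial_minus_one)
  also have "\<dots> = fps_binomial (of_int n)"
    using False by (simp add: fps_binomial_power)
  finally show ?thesis .
qed

lemma sums_power_int:
  fixes q :: complex
  assumes "norm (q - 1) < 1"
  shows "(\<lambda>i. (of_int n gchoose i) * (q - 1) ^ i) sums (q powi n)"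
proof -
  have "q \<noteq> 0" using assms by auto
  then show ?thesis
    using gen_binomial_complex[OF assms, of "of_int n"] by (simp add: complex_powr_of_int)
qed


section \<open>The ternary Virasoro-Witt algebra\<close>

context virasoro_witt
begin

text \<open>Homogeneous elements of degree \<open>n\<close>. They contain both kinds of generators
  and are closed under the bracket, so the one formula \<open>br_E\<close> replaces a case
  distinction on every nested bracket.\<close>

definition E :: "complex \<Rightarrow> complex \<Rightarrow> int \<Rightarrow> 'w" where
  "E a b n = scale a (Q n) + scale b (R n)"

lemma Q_eq_E: "Q n = E 1 0 n" and R_eq_E: "R n = E 0 1 n"
  by (simp_all add: E_def)

lemma E_add: "E a b n + E c d n = E (a + c) (b + d) n"
  by (simp add: E_def scale_left_distrib)

lemma E_scale: "scale c (E a b n) = E (c * a) (c * b) n"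
  by (simp add: E_def scale_right_distrib)

lemma E_minus: "- E a b n = E (- a) (- b) n"
  by (simp add: E_def)

lemma br_generators:
  "br (Q k) (Q m) (Q n) = E 0 (of_int ((k - m) * (m - n) * (k - n))) (k + m + n)"
  "br (Q k) (Q m) (R n) = E (of_int (k - m)) (of_int (k - m) * (z * of_int n)) (k + m + n)"
  "br (Q k) (R m) (Q n) = E (- of_int (k - n)) (- of_int (k - n) * (z * of_int m)) (k + m + n)"
  "br (R k) (Q m) (Q n) = E (of_int (m - n)) (of_int (m - n) * (z * of_int k)) (k + m + n)"
  "br (Q k) (R m) (R n) = E 0 (of_int (n - m)) (k + m + n)"
  "br (R k) (Q m) (R n) = E 0 (- of_int (n - k)) (k + m + n)"
  "br (R k) (R m) (Q n) = E 0 (of_int (m - k)) (k + m + n)"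
  "br (R k) (R m) (R n) = E 0 0 (k + m + n)"
proof -
  note swap12 = skew_symmetric_onD(1)[OF skew_symmetric]
  note swap23 = skew_symmetric_onD(2)[OF skew_symmetric]
  show QQQ: "br (Q k) (Q m) (Q n) = E 0 (of_int ((k - m) * (m - n) * (k - n))) (k + m + n)" for k m n
    by (simp add: br_QQQ E_def)
  show QQR: "br (Q k) (Q m) (R n) = E (of_int (k - m)) (of_int (k - m) * (z * of_int n)) (k + m + n)" for k m n
    by (simp add: br_QQR E_def scale_right_distrib)
  show QRQ: "br (Q k) (R m) (Q n) = E (- of_int (k - n)) (- of_int (k - n) * (z * of_int m)) (k + m + n)" for k m n
    unfolding swap23[of "Q k" "R m"] QQR E_minus by (simp add: algebra_simps)
  show "br (R k) (Q m) (Q n) = E (of_int (m - n)) (of_int (m - n) * (z * of_int k)) (k + m + n)" for k m n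
    unfolding swap12[of "R k" "Q m"] QRQ E_minus by (simp add: algebra_simps)
  show QRR: "br (Q k) (R m) (R n) = E 0 (of_int (n - m)) (k + m + n)" for k m n
    by (simp add: br_QRR E_def)
  show RQR: "br (R k) (Q m) (R n) = E 0 (- of_int (n - k)) (k + m + n)" for k m n
    unfolding swap12[of "R k" "Q m"] QRR E_minus by (simp add: algebra_simps)
  show "br (R k) (R m) (Q n) = E 0 (of_int (m - k)) (k + m + n)" for k m n
    unfolding swap23[of "R k" "R m"] RQR E_minus by (simp add: algebra_simps)
  show "br (R k) (R m) (R n) = E 0 0 (k + m + n)" for k m n
    by (simp add: br_RRR E_def)
qed

lemma br_E:
  "br (E a b k) (E a' b' m) (E a'' b'' n) = E
     (a * a' * b'' * of_int (k - m) - a * b' * a'' * of_int (k - n) + b * a' * a'' * of_int (m - n))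
     (a * a' * a'' * of_int ((k - m) * (m - n) * (k - n))
       + z * (a * a' * b'' * of_int ((k - m) * n) - a * b' * a'' * of_int ((k - n) * m)
              + b * a' * a'' * of_int ((m - n) * k))
       + a * b' * b'' * of_int (n - m) - b * a' * b'' * of_int (n - k) + b * b' * a'' * of_int (m - k))
     (k + m + n)"
  unfolding E_def[of a b] E_def[of a' b'] E_def[of a'' b'']
  by (simp only: trilinear_onD[OF trilinear] br_generators E_scale E_add)
    (rule arg_cong2[where f = "\<lambda>p r. E p r (k + m + n)"]; simp add: algebra_simps)

lemma nambu_identity:
  assumes z: "z * z = - 4"
  shows "nambu_identity_at br x1 x2 x3 x4 x5"
proof (rule nambu_identityI[OF determining_set_span[OF generating] trilinear])
  fix x1 x2 x3 x4 x5
  assume gen: "x1 \<in> range Q \<union> range R" "x2 \<in> range Q \<union> range R" "x3 \<in> range Q \<union> range R"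
    "x4 \<in> range Q \<union> range R" "x5 \<in> range Q \<union> range R"
  have gen_E: "\<exists>n a b. x = E a b n \<and> (a = 1 \<and> b = 0 \<or> a = 0 \<and> b = 1)"
    if "x \<in> range Q \<union> range R" for x
    using that by (auto simp: Q_eq_E R_eq_E)
  obtain n1 a1 b1 where x1: "x1 = E a1 b1 n1" "a1 = 1 \<and> b1 = 0 \<or> a1 = 0 \<and> b1 = 1"
    using gen_E[OF gen(1)] by auto
  obtain n2 a2 b2 where x2: "x2 = E a2 b2 n2" "a2 = 1 \<and> b2 = 0 \<or> a2 = 0 \<and> b2 = 1"
    using gen_E[OF gen(2)] by auto
  obtain n3 a3 b3 where x3: "x3 = E a3 b3 n3" "a3 = 1 \<and> b3 = 0 \<or> a3 = 0 \<and> b3 = 1"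
    using gen_E[OF gen(3)] by auto
  obtain n4 a4 b4 where x4: "x4 = E a4 b4 n4" "a4 = 1 \<and> b4 = 0 \<or> a4 = 0 \<and> b4 = 1"
    using gen_E[OF gen(4)] by auto
  obtain n5 a5 b5 where x5: "x5 = E a5 b5 n5" "a5 = 1 \<and> b5 = 0 \<or> a5 = 0 \<and> b5 = 1"
    using gen_E[OF gen(5)] by auto
  \<comment> \<open>All four terms of the identity have the same total degree. Writing it in one way
    lets \<open>E_add\<close> merge the right-hand side, and only coefficients remain to be
    compared.\<close>
  have deg: "n1 + n2 + n3 + n4 + n5 = n1 + n2 + (n3 + n4 + n5)"
    "n3 + (n1 + n2 + n4) + n5 = n1 + n2 + (n3 + n4 + n5)"
    "n3 + n4 + (n1 + n2 + n5) = n1 + n2 + (n3 + n4 + n5)"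
    by simp_all
  \<comment> \<open>The value of \<open>z * z\<close>, in the right-nested shape that
    \<open>algebra_simps\<close> produces.\<close>
  have zz: "z * (z * u) = - 4 * u" for u
    using z by (simp flip: mult.assoc)
  have E_cong: "E a b n = E a' b' n" if "a = a'" "b = b'" for a a' b b' n
    using that by simp
  show "nambu_identity_at br x1 x2 x3 x4 x5"
    unfolding nambu_identity_at_def x1(1) x2(1) x3(1) x4(1) x5(1) br_E deg E_add
    using x1(2) x2(2) x3(2) x4(2) x5(2)
    \<comment> \<open>Choosing \<open>Q\<close> or \<open>R\<close> in each slot gives 32 cases;
      each is a pair of polynomial identities in the degrees and \<open>z\<close>, modulo
      \<open>z * z = - 4\<close>.\<close>
    apply (elim disjE conjE)
    apply (simp_all only: mult_1_left mult_1_right mult_zero_left mult_zero_right add_0_left add_0_right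
        diff_0 diff_0_right minus_zero of_int_add of_int_mult of_int_diff)
    apply (rule E_cong; simp add: algebra_simps zz)+
    done
qed

end

theorem proposition2:
  fixes scale :: "complex \<Rightarrow> 'w::ab_group_add \<Rightarrow> 'w"
    and Q R :: "int \<Rightarrow> 'w"
    and z :: complex
    and br :: "'w \<Rightarrow> 'w \<Rightarrow> 'w \<Rightarrow> 'w"
    and \<rho> :: "complex \<Rightarrow> 'w \<Rightarrow> 'w"
  assumes "z = 2 * \<i> \<or> z = - 2 * \<i>"
    and "virasoro_witt scale Q R z br"
    and "\<And>q. q \<noteq> 0 \<Longrightarrow> q_twist scale Q R q (\<rho> q)"
  shows "\<exists>(B :: nat \<Rightarrow> 'w \<Rightarrow> 'w \<Rightarrow> 'w \<Rightarrow> 'w) (A :: nat \<Rightarrow> 'w \<Rightarrow> 'w).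
           q_expansion scale Q R br \<rho> B A \<and>
           formal_deformation scale br id id B A A"
proof -
  interpret virasoro_witt scale Q R z br by (rule assms(2))
  have z: "z * z = - 4"
    using assms(1) by auto
  define S where "S = range Q \<union> range R"
  have span_S: "span S = UNIV"
    unfolding S_def by (rule generating)
  note \<rho> = assms(3)[unfolded q_twist_def]
  have lin_\<rho>: "module_hom scale scale (\<rho> q)" if "q \<noteq> 0" for q
    using \<rho>[OF that] by blast
  have \<rho>_E: "\<rho> q (E a b n) = scale (q powi n) (E a b n)" if "q \<noteq> 0" for q a b n
    using \<rho>[OF that]
    by (simp add: E_def module_hom.add[OF lin_\<rho>[OF that]] module_hom.scale[OF lin_\<rho>[OF that]]
        scale_right_distrib mult.commute)
  have S_E: "\<exists>a b n. s = E a b n" if "s \<in> S" for s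
    using that by (auto simp: S_def Q_eq_E R_eq_E)
  \<comment> \<open>The scalar 2 has pairwise distinct integer powers, so the eigenvalues of
    \<open>\<rho> 2\<close> separate the degrees. Taking norms reduces this to monotonicity of real
    powers.\<close>
  have inj: "inj (\<lambda>n::int. (2::complex) powi n)"
  proof (rule injI)
    fix m n :: int
    assume "(2::complex) powi m = 2 powi n"
    then have "norm ((2::complex) powi m) = norm ((2::complex) powi n)" by simp
    then have "(2::real) powi m = 2 powi n" by (simp add: norm_power_int)
    then show "m = n"
      using power_int_strict_increasing[of m n "2::real"] power_int_strict_increasing[of n m "2::real"]
      by (cases m n rule: linorder_cases) auto
  qed
  \<comment> \<open>The eigenspaces of \<open>\<rho> 2\<close> grade \<open>W\<close>, which makes the \<open>A\<^sub>i\<close> well defined even if the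
    generators are linearly dependent.\<close>
  have "\<exists>D. module_hom scale scale D \<and> (\<forall>a b n. D (E a b n) = scale (of_int n gchoose i) (E a b n))" for i
  proof -
    obtain D where "module_hom scale scale D"
      and "\<And>n v. \<rho> 2 v = scale (2 powi n) v \<Longrightarrow> D v = scale (of_int n gchoose i) v"
      by (rule exists_diagonal[OF lin_\<rho>[of 2] inj span_S, of "\<lambda>n. of_int n gchoose i"])
        (use S_E \<rho>_E[of 2] in force)+
    then show ?thesis using \<rho>_E[of 2] by auto
  qed
  then obtain A where lin_A: "\<And>i. module_hom scale scale (A i)"
    and A_E: "\<And>i a b n. A i (E a b n) = scale (of_int n gchoose i) (E a b n)"
    by metis
  define B where "B i = q_bracket (A i) br" for i
  have B: "formal_bracket B = q_bracket (formal_map A) (hom_ext3 br)"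
    unfolding B_def[abs_def] by (rule module.formal_bracket_eq[OF module_axioms lin_A])
  interpret fps: module "fps_scale scale" by (rule module_fps)
  have lin_At: "module_hom (fps_scale scale) (fps_scale scale) (formal_map A)"
    by (rule module.module_hom_formal_map[OF module_axioms lin_A])
  have At_E: "formal_map A (fps_const (E a b n)) =
      fps_scale scale (fps_binomial (of_int n)) (fps_const (E a b n))" for a b n
    by (simp add: module.formal_map_fps_const[OF module_axioms lin_A] fps_scale_fps_const_right A_E)
  have twist: "q_twist (fps_scale scale) (\<lambda>n. fps_const (Q n)) (\<lambda>n. fps_const (R n))
      (1 + fps_X) (formal_map A)"
    unfolding q_twist_def
    using lin_At by (simp add: power_int_one_plus_fps_X Q_eq_E R_eq_E At_E)
  have sums: "(\<lambda>i. f (A i x) * (q - 1) ^ i) sums f (\<rho> q x)"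
    if q: "norm (q - 1) < 1" and f: "module_hom scale (*) f" for q f x
  proof -
    interpret f: module_hom scale "(*)" f by (rule f)
    have "q \<noteq> 0" using q by auto
    note lin = lin_\<rho>[OF this]
    \<comment> \<open>For a fixed functional the good arguments form a subspace; on generators the
      claim is the binomial series of \<open>q powi n\<close> times a constant.\<close>
    let ?U = "{x. (\<lambda>i. f (A i x) * (q - 1) ^ i) sums f (\<rho> q x)}"
    have "subspace ?U"
    proof (rule subspaceI)
      show "0 \<in> ?U"
        by (simp add: module_hom.zero[OF lin_A] module_hom.zero[OF lin] f.zero)
      show "x + y \<in> ?U" if "x \<in> ?U" "y \<in> ?U" for x y
        using that sums_add
        by (fastforce simp: module_hom.add[OF lin_A] module_hom.add[OF lin] f.add distrib_right)
      show "scale c x \<in> ?U" if "x \<in> ?U" for c x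
        using that sums_mult[of _ _ c]
        by (fastforce simp: module_hom.scale[OF lin_A] module_hom.scale[OF lin] f.scale mult.assoc)
    qed
    moreover have "S \<subseteq> ?U"
    proof
      fix s assume "s \<in> S"
      then obtain a b n where s: "s = E a b n" using S_E by blast
      show "s \<in> ?U"
        using sums_mult2[OF sums_power_int[OF q, of n], of "f s"]
        by (simp add: s A_E \<rho>_E[OF \<open>q \<noteq> 0\<close>] f.scale ac_simps)
    qed
    ultimately have "span S \<subseteq> ?U" by (rule span_minimal[rotated])
    then show ?thesis using span_S by auto
  qed
  \<comment> \<open>The expansion of the bracket is that of the twisting map at the argument
    \<open>br x y w\<close>.\<close>
  have "q_expansion scale Q R br \<rho> B A"
    unfolding q_expansion_def using twist B sums by (auto simp: B_def q_bracket_def)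
  \<comment> \<open>The undeformed algebra is the twist by the identity.\<close>
  moreover have "ternary_hom_nambu_lie_algebra scale br id id"
    using yau_twist[OF trilinear skew_symmetric nambu_identity[OF z], of id]
    by (simp add: q_bracket_def[abs_def] module_hom_iff module_axioms)
  moreover have "ternary_hom_nambu_lie_algebra (fps_scale scale) (formal_bracket B) (formal_map A) (formal_map A)"
    unfolding B
  proof (rule yau_twist)
    note tri = trilinear_hom_ext3[OF trilinear skew_symmetric]
    note det = determining_set_fps[OF span_S]
    show "trilinear_on (fps_scale scale) (hom_ext3 br)" by (rule tri)
    show "skew_symmetric_on (fps_scale scale) (hom_ext3 br)"
      by (rule skew_symmetric_hom_ext3[OF skew_symmetric])
    show "module_hom (fps_scale scale) (fps_scale scale) (formal_map A)" by (rule lin_At)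
    show "nambu_identity_at (hom_ext3 br) x1 x2 x3 x4 x5" for x1 x2 x3 x4 x5
    proof (rule nambu_identityI[OF det tri])
      fix x1 x2 x3 x4 x5
      assume "x1 \<in> fps_const ` S" "x2 \<in> fps_const ` S" "x3 \<in> fps_const ` S"
        "x4 \<in> fps_const ` S" "x5 \<in> fps_const ` S"
      then obtain v1 v2 v3 v4 v5 where v: "x1 = fps_const v1" "x2 = fps_const v2" "x3 = fps_const v3"
        "x4 = fps_const v4" "x5 = fps_const v5"
        by blast
      \<comment> \<open>On constants the extended bracket is \<open>br\<close> itself, so the
        identity is the one in \<open>W\<close>.\<close>
      show "nambu_identity_at (hom_ext3 br) x1 x2 x3 x4 x5"
        using nambu_identity[OF z, of v1 v2 v3 v4 v5]
        unfolding nambu_identity_at_def v hom_ext3_fps_const[OF trilinear] fps_const_add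
        by (rule arg_cong)
    qed
    let ?l = "\<lambda>x y w. formal_map A (hom_ext3 br x y w)"
    let ?r = "\<lambda>x y w. hom_ext3 br (formal_map A x) (formal_map A y) (formal_map A w)"
    show "?l x y w = ?r x y w" for x y w
    proof (rule trilinear_on_eqI[OF det, of ?l ?r])
      note At = module_hom.add[OF lin_At] module_hom.scale[OF lin_At]
      show "trilinear_on (fps_scale scale) ?l" "trilinear_on (fps_scale scale) ?r"
        unfolding trilinear_on_def
        by (simp_all add: module_hom_iff trilinear_onD[OF tri] At module_fps)
      have const_S_E: "\<exists>a b n. x = fps_const (E a b n)" if "x \<in> fps_const ` S" for x
        using that S_E by blast
      fix x y w
      assume "x \<in> fps_const ` S" "y \<in> fps_const ` S" "w \<in> fps_const ` S"
      then obtain a b k a' b' m a'' b'' n where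
        xyw: "x = fps_const (E a b k)" "y = fps_const (E a' b' m)" "w = fps_const (E a'' b'' n)"
        using const_S_E[of x] const_S_E[of y] const_S_E[of w] by blast
      \<comment> \<open>Only the degree of the bracket matters: the left side acquires
        \<open>(1 + t)\<close> to the power \<open>k + m + n\<close>, the right side the product of
        the three separate powers.\<close>
      obtain c d where br: "br (E a b k) (E a' b' m) (E a'' b'' n) = E c d (k + m + n)"
        using br_E by blast
      show "?l x y w = ?r x y w"
        unfolding xyw At_E trilinear_onD[OF tri] hom_ext3_fps_const[OF trilinear] br
        by (simp add: fps_binomial_add_mult ac_simps)
    qed
  qed
  moreover have "A 0 = id"
  proof
    fix x
    show "A 0 x = id x"
      by (rule determining_set_eqI[OF determining_set_span[OF span_S] lin_A])
        (auto dest!: S_E simp: A_E module_hom_iff module_axioms)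
  qed
  moreover have "B 0 = br"
    by (simp add: B_def q_bracket_def[abs_def] \<open>A 0 = id\<close>)
  moreover have "trilinear_on scale (B i)" for i
    unfolding B_def q_bracket_def trilinear_on_def
    by (simp add: module_hom_iff trilinear_onD[OF trilinear] module_hom.add[OF lin_A]
        module_hom.scale[OF lin_A] module_axioms)
  ultimately show ?thesis
    using lin_A unfolding formal_deformation_def by blast
qed

end
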